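(* Let $K\subseteq L$ be a field extension. Then $K+XL[X]$, the subring of $L[X]$ consisting of the polynomials with constant term in $K$, is a TAF-domain.
   Context: An ideal $I$ of a commutative ring $R$ is a 2-absorbing ideal (TA-ideal) if whenever $a,b,c\in R$ and $abc\in I$, then $ab\in I$ or $ac\in I$ or $bc\in I$. A TA-factorization of an ideal $I$ is an expression $I=J_1\cdots J_n$ as a product of proper TA-ideals. A TAF-domain is an integral domain in which every proper ideal has a TA-factorization. *)

theory Defs
  imports "HOL-Algebra.Algebra"
begin

definition TA_ideal :: "'a set \<Rightarrow> ('a, 'b) ring_scheme \<Rightarrow> bool"
  where "TA_ideal I R \<longleftrightarrow>
    ideal I R \<and>
    (\<forall>a \<in> carrier R. \<forall>b \<in> carrier R. \<forall>c \<in> carrier R.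
       a \<otimes>\<^bsub>R\<^esub> b \<otimes>\<^bsub>R\<^esub> c \<in> I \<longrightarrow>
       a \<otimes>\<^bsub>R\<^esub> b \<in> I \<or> a \<otimes>\<^bsub>R\<^esub> c \<in> I \<or> b \<otimes>\<^bsub>R\<^esub> c \<in> I)"

(* The neutral element of ideal multiplication is carrier R, which is why the fold starts there. *)
definition TA_factorization :: "'a set list \<Rightarrow> 'a set \<Rightarrow> ('a, 'b) ring_scheme \<Rightarrow> bool"
  where "TA_factorization Js I R \<longleftrightarrow>
    Js \<noteq> [] \<and>
    (\<forall>J \<in> set Js. TA_ideal J R \<and> J \<noteq> carrier R) \<and>
    I = foldr (ideal_prod R) Js (carrier R)"

definition TAF_domain :: "('a, 'b) ring_scheme \<Rightarrow> bool"
  where "TAF_domain R \<longleftrightarrow>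
    domain R \<and>
    (\<forall>I. ideal I R \<and> I \<noteq> carrier R \<longrightarrow> (\<exists>Js. TA_factorization Js I R))"

(* K + X L[X] inside L[X], where L[X] is the library's univ_poly L (carrier L). *)
definition const_term_subring :: "'a set \<Rightarrow> ('a, 'b) ring_scheme \<Rightarrow> ('a list) ring"
  where "const_term_subring K L =
    (univ_poly L (carrier L))
      \<lparr> carrier := {p \<in> carrier (univ_poly L (carrier L)). ring.const_term L p \<in> K} \<rparr>"

end

theory Submission
  imports Defs
begin

text \<open>
  Let \<open>P = L[X]\<close>, \<open>M = XP\<close> and \<open>S = K + M\<close>. A nonzero ideal \<open>I\<close> of \<open>S\<close> that generates \<open>fP\<close> in \<open>P\<close>
  satisfies \<open>Xf P \<subseteq> I \<subseteq> f P\<close>. If an irreducible factor of \<open>f\<close> has nonzero constant term, scaling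
  it by an element of \<open>L\<close> gives \<open>g \<in> S\<close> with \<open>gS\<close> prime and \<open>I \<subseteq> gS\<close>; if \<open>X\<^sup>2\<close> divides \<open>f\<close>, then
  \<open>I \<subseteq> XS\<close>. In both cases \<open>I = gS \<cdot> (I : g)\<close>, and one continues with \<open>(I : g)\<close>. Otherwise \<open>f\<close> is
  associated to \<open>1\<close> or \<open>X\<close>, so \<open>M\<^sup>2 \<subseteq> I \<subseteq> M\<close> or \<open>I = S\<close>. As \<open>M\<close> is maximal in \<open>S\<close>, every ideal
  between \<open>M\<^sup>2\<close> and \<open>M\<close> is 2-absorbing; this applies to \<open>XS\<close> as well.
\<close>

section \<open>Colon ideals and 2-absorbing ideals in a commutative ring\<close>

lemma (in cring) ideal_colon_element:
  assumes "ideal I R" "g \<in> carrier R"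
  shows "ideal {h \<in> carrier R. g \<otimes> h \<in> I} R"
proof -
  interpret I: ideal I R by fact
  show ?thesis
  proof (rule idealI[OF ring_axioms])
    show "subgroup {h \<in> carrier R. g \<otimes> h \<in> I} (add_monoid R)"
      by (rule add.subgroupI)
         (use assms(2) in \<open>auto simp: r_distr r_minus simp flip: a_inv_def intro: exI[of _ \<zero>]\<close>)
  next
    fix a y assume a: "a \<in> {h \<in> carrier R. g \<otimes> h \<in> I}" and y: "y \<in> carrier R"
    have "g \<otimes> (y \<otimes> a) = y \<otimes> (g \<otimes> a)"
      using a y assms(2) by (simp add: m_lcomm)
    then show "y \<otimes> a \<in> {h \<in> carrier R. g \<otimes> h \<in> I}"
      using a y I.I_l_closed by auto
    then show "a \<otimes> y \<in> {h \<in> carrier R. g \<otimes> h \<in> I}"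
      using a y by (simp add: m_comm)
  qed
qed

text \<open>This splits a principal factor off \<open>I\<close>. Each \<open>i\<close> in
  \<open>I\<close> is a multiple of \<open>g\<close>, and its cofactor lies in the colon ideal by
  definition. Conversely a generator of the product has the form \<open>r g j\<close> with
  \<open>g j\<close> in \<open>I\<close>.\<close>

lemma (in cring) ideal_prod_cgenideal_colon:
  assumes "ideal I R" "g \<in> carrier R" "I \<subseteq> PIdl g"
  shows "I = (PIdl g) \<cdot> {h \<in> carrier R. g \<otimes> h \<in> I}" (is "I = _ \<cdot> ?J")
proof
  interpret I: ideal I R by fact
  show "I \<subseteq> (PIdl g) \<cdot> ?J"
  proof
    fix i assume "i \<in> I"
    then obtain h where h: "h \<in> carrier R" "i = h \<otimes> g"
      using assms(3) unfolding cgenideal_def by blast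
    then have "i = g \<otimes> h" using assms(2) by (simp add: m_comm)
    then show "i \<in> (PIdl g) \<cdot> ?J"
      using h \<open>i \<in> I\<close> ideal_prod.prod[OF cgenideal_self[OF assms(2)], of h ?J R] by auto
  qed
  show "(PIdl g) \<cdot> ?J \<subseteq> I"
  proof
    fix s assume "s \<in> (PIdl g) \<cdot> ?J"
    then show "s \<in> I"
    proof (induct s rule: ideal_prod.induct)
      case (prod i j)
      then obtain r where "r \<in> carrier R" "i = r \<otimes> g"
        unfolding cgenideal_def by blast
      then have "i \<otimes> j = r \<otimes> (g \<otimes> j)" using prod assms(2) by (simp add: m_assoc)
      then show ?case using prod \<open>r \<in> carrier R\<close> I.I_l_closed by auto
    qed auto
  qed
qed

lemma (in cring) primeideal_imp_TA_ideal:
  assumes "primeideal I R"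
  shows "TA_ideal I R"
proof -
  interpret I: primeideal I R by fact
  have "a \<otimes> b \<in> I \<or> a \<otimes> c \<in> I \<or> b \<otimes> c \<in> I"
    if "a \<in> carrier R" "b \<in> carrier R" "c \<in> carrier R" "a \<otimes> b \<otimes> c \<in> I" for a b c
    using that I.I_prime[of "a \<otimes> b" c] I.I_l_closed[of c a] by auto
  then show ?thesis
    unfolding TA_ideal_def using I.is_ideal by blast
qed

text \<open>If \<open>a b c\<close> lies in \<open>I\<close>, then primeness of \<open>M\<close>
  puts a factor in \<open>M\<close>. With two factors in \<open>M\<close>, their product is in
  \<open>I\<close> by \<open>sq\<close>. With only one, say \<open>a\<close>, the product
  \<open>d\<close> of the other two is outside \<open>M\<close>; the colon ideal of \<open>I\<close>
  by \<open>a\<close> contains \<open>M\<close> and also \<open>d\<close>, so it is the whole ring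
  and \<open>a\<close> itself is in \<open>I\<close>.\<close>

lemma (in cring) TA_ideal_between_maximal_square:
  assumes M: "maximalideal M R" and I: "ideal I R" "I \<subseteq> M"
    and sq: "\<And>a b. a \<in> M \<Longrightarrow> b \<in> M \<Longrightarrow> a \<otimes> b \<in> I"
  shows "TA_ideal I R"
proof -
  interpret M: maximalideal M R by fact
  interpret P: primeideal M R by (rule maximalideal_prime[OF M])
  interpret I: ideal I R by fact
  have absorb: "a \<in> I" if "a \<in> M" "d \<in> carrier R" "d \<notin> M" "a \<otimes> d \<in> I" for a d
  proof -
    let ?J = "{h \<in> carrier R. a \<otimes> h \<in> I}"
    have a: "a \<in> carrier R" using that(1) by (rule M.Icarr)
    have "?J = M \<or> ?J = carrier R"
      by (rule M.I_maximal) (use that ideal_colon_element[OF I(1) a] sq M.Icarr in auto)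
    moreover have "d \<in> ?J" using that by auto
    ultimately have "?J = carrier R" using that(3) by blast
    then have "\<one> \<in> ?J" by simp
    then show ?thesis using a by simp
  qed
  have "a \<otimes> b \<in> I \<or> a \<otimes> c \<in> I \<or> b \<otimes> c \<in> I"
    if abc: "a \<in> carrier R" "b \<in> carrier R" "c \<in> carrier R" "a \<otimes> b \<otimes> c \<in> I" for a b c
  proof -
    have eqs: "a \<otimes> b \<otimes> c = a \<otimes> (b \<otimes> c)" "a \<otimes> b \<otimes> c = b \<otimes> (a \<otimes> c)" "a \<otimes> b \<otimes> c = c \<otimes> (a \<otimes> b)"
      using abc by (simp_all add: m_ac)
    have notM: "u \<otimes> v \<notin> M" if "u \<in> carrier R" "v \<in> carrier R" "u \<notin> M" "v \<notin> M" for u v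
      using that P.I_prime by blast
    have "a \<otimes> b \<otimes> c \<in> M" using abc(4) I(2) by blast
    then have "a \<in> M \<or> b \<in> M \<or> c \<in> M" using notM abc(1-3) m_closed by metis
    moreover have "a \<in> M \<Longrightarrow> b \<notin> M \<Longrightarrow> c \<notin> M \<Longrightarrow> a \<in> I"
      using absorb[of a "b \<otimes> c"] abc eqs notM by auto
    moreover have "b \<in> M \<Longrightarrow> a \<notin> M \<Longrightarrow> c \<notin> M \<Longrightarrow> b \<in> I"
      using absorb[of b "a \<otimes> c"] abc eqs notM by auto
    moreover have "c \<in> M \<Longrightarrow> a \<notin> M \<Longrightarrow> b \<notin> M \<Longrightarrow> c \<in> I"
      using absorb[of c "a \<otimes> b"] abc eqs notM by auto
    ultimately show ?thesis
      using sq abc I.I_l_closed I.I_r_closed by metis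
  qed
  then show ?thesis unfolding TA_ideal_def using I(1) by blast
qed

section \<open>The pullback ring \<open>S\<close> and its maximal ideal \<open>M\<close>\<close>

text \<open>
  The argument only uses that \<open>C\<close> is the preimage of a subfield under \<open>R \<rightarrow> R / xR\<close>, where units
  of \<open>R\<close> reach every nonzero class up to that subfield.
\<close>

locale principal_domain_pullback = principal_domain +
  fixes C :: "'a set" and x :: 'a
  assumes subring_C: "subring C R"
    and x_closed: "x \<in> carrier R"
    and x_prime: "ring_prime x"
    and x_mult_C: "p \<in> carrier R \<Longrightarrow> x \<otimes> p \<in> C"
    and inverse_mod_x: "\<lbrakk> a \<in> C; a \<notin> PIdl x \<rbrakk> \<Longrightarrow> \<exists>s \<in> C. \<exists>m \<in> PIdl x. a \<otimes> s = \<one> \<oplus> m"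
    and unit_multiple_C: "\<lbrakk> a \<in> carrier R; a \<notin> PIdl x \<rbrakk> \<Longrightarrow> \<exists>u \<in> Units R. u \<otimes> a \<in> C"
begin

abbreviation S where "S \<equiv> R\<lparr>carrier := C\<rparr>"
abbreviation M where "M \<equiv> PIdl x"

lemma C_subset: "C \<subseteq> carrier R"
  using subringE(1)[OF subring_C] .

lemma C_carrier: "a \<in> C \<Longrightarrow> a \<in> carrier R"
  using C_subset by blast

lemma domain_S: "domain S"
  by (rule subring_is_domain[OF subring_C])

lemma M_primeideal: "primeideal M R"
  using primeideal_iff_prime[of x] x_closed x_prime by (auto simp: ring_prime_def)

lemma M_subset_C: "M \<subseteq> C"
  using x_mult_C x_closed by (auto simp: cgenideal_def m_comm)

lemma x_in_M: "x \<in> M"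
  by (rule cgenideal_self[OF x_closed])

lemma cgenideal_S: "PIdl\<^bsub>S\<^esub> g = {h \<otimes> g | h. h \<in> C}"
  by (simp add: cgenideal_def)

text \<open>An inverse \<open>s\<close> of \<open>g\<close> modulo \<open>M\<close> can be chosen in
  \<open>C\<close>. With \<open>g s = 1 + m\<close> it gives \<open>h = h g s - h m\<close>, where
  \<open>h g s\<close> is in \<open>C\<close> and \<open>h m\<close> is in \<open>M\<close>, hence
  in \<open>C\<close>.\<close>

lemma C_cancel:
  assumes "g \<in> C" "g \<notin> M" "h \<in> carrier R" "h \<otimes> g \<in> C"
  shows "h \<in> C"
proof -
  interpret M: primeideal M R by (rule M_primeideal)
  obtain s m where s: "s \<in> C" and m: "m \<in> M" "g \<otimes> s = \<one> \<oplus> m"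
    using inverse_mod_x assms by blast
  have c: "s \<in> carrier R" "m \<in> carrier R" "g \<in> carrier R"
    using s m assms C_carrier M.Icarr by auto
  have "h \<otimes> g \<otimes> s = h \<oplus> h \<otimes> m"
    using m(2) c assms(3) by (simp add: m_assoc r_distr)
  then have "h = h \<otimes> g \<otimes> s \<ominus> h \<otimes> m"
    using c assms(3) by (simp add: a_minus_def a_assoc r_neg)
  moreover have "h \<otimes> m \<in> C" using M.I_l_closed m(1) assms(3) M_subset_C by blast
  ultimately show ?thesis
    using subringE(5,6,7)[OF subring_C] s assms(4) unfolding a_minus_def by metis
qed

text \<open>By \<open>inverse_mod_x\<close>, every element of \<open>C\<close> outside
  \<open>M\<close> is invertible modulo \<open>M\<close> within \<open>C\<close>, so an ideal of
  \<open>S\<close> that properly contains \<open>M\<close> contains 1.\<close>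

lemma M_maximalideal: "maximalideal M S"
proof -
  interpret M: primeideal M R by (rule M_primeideal)
  interpret S: domain S by (rule domain_S)
  show ?thesis
  proof (rule maximalidealI)
    show "ideal M S"
    proof (rule idealI[OF S.ring_axioms])
      show "subgroup M (add_monoid S)"
        using add.subgroup_incl[OF M.a_subgroup subring.axioms(1)[OF subring_C] M_subset_C]
        by simp
    qed (use C_carrier M.I_l_closed M.I_r_closed in auto)
    show "carrier S \<noteq> M"
      using M.I_notcarr M.one_imp_carrier subringE(3)[OF subring_C] by auto
    fix J assume J: "ideal J S" "M \<subseteq> J" "J \<subseteq> carrier S"
    interpret J: ideal J S by fact
    show "J = M \<or> J = carrier S"
    proof (cases "J \<subseteq> M")
      case False
      then obtain a where a: "a \<in> J" "a \<notin> M" by blast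
      then obtain s m where s: "s \<in> C" and m: "m \<in> M" "a \<otimes> s = \<one> \<oplus> m"
        using inverse_mod_x[of a] J by auto
      have "a \<otimes> s \<in> J" using J.I_r_closed[of a s] a s by simp
      have "m \<in> carrier R" using m M.Icarr by blast
      moreover have "\<ominus>\<^bsub>R\<^esub> m \<in> M" using m by simp
      ultimately have "\<one> = (\<one> \<oplus> m) \<oplus> (\<ominus> m)" "\<ominus> m \<in> J" using J by (auto simp: a_assoc r_neg)
      then have "\<one> \<in> J" using J.a_closed[of "a \<otimes> s" "\<ominus> m"] \<open>a \<otimes> s \<in> J\<close> m(2) by simp
      then show ?thesis using J.one_imp_carrier by simp
    qed (use J in blast)
  qed
qed

text \<open>By \<open>C_cancel\<close> the ideal that \<open>g\<close> generates in \<open>S\<close>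
  is the contraction of the one it generates in \<open>R\<close>, and contractions of primes are
  prime.\<close>

lemma primeideal_cgenideal_S:
  assumes g: "g \<in> C" "g \<notin> M" and prime: "primeideal (PIdl g) R"
  shows "primeideal (PIdl\<^bsub>S\<^esub> g) S"
proof -
  interpret S: domain S by (rule domain_S)
  interpret P: primeideal "PIdl g" R by (rule prime)
  have eq: "PIdl\<^bsub>S\<^esub> g = PIdl g \<inter> C"
  proof
    show "PIdl\<^bsub>S\<^esub> g \<subseteq> PIdl g \<inter> C"
      using g C_subset subringE(6)[OF subring_C] unfolding cgenideal_S unfolding cgenideal_def by blast
    show "PIdl g \<inter> C \<subseteq> PIdl\<^bsub>S\<^esub> g"
      using g C_cancel unfolding cgenideal_S unfolding cgenideal_def by blast
  qed
  show ?thesis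
  proof (rule primeidealI)
    show "ideal (PIdl\<^bsub>S\<^esub> g) S" using S.cgenideal_ideal g by simp
    show "cring S" by (rule S.cring_axioms)
    show "carrier S \<noteq> PIdl\<^bsub>S\<^esub> g"
      using P.I_notcarr P.one_imp_carrier subringE(3)[OF subring_C] eq by auto
    fix a b assume "a \<in> carrier S" "b \<in> carrier S" "a \<otimes>\<^bsub>S\<^esub> b \<in> PIdl\<^bsub>S\<^esub> g"
    then show "a \<in> PIdl\<^bsub>S\<^esub> g \<or> b \<in> PIdl\<^bsub>S\<^esub> g"
      using P.I_prime[of a b] C_carrier unfolding eq by auto
  qed
qed

text \<open>The multiples of \<open>x\<close> by elements of \<open>C\<close> lie between the square
  of \<open>M\<close> and \<open>M\<close>: for \<open>a\<close> in \<open>M\<close>, the product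
  \<open>a (r x) = (a r) x\<close> has its cofactor \<open>a r\<close> in \<open>M\<close>, hence in
  \<open>C\<close>.\<close>

lemma TA_ideal_cgenideal_x: "TA_ideal (PIdl\<^bsub>S\<^esub> x) S"
proof -
  interpret S: domain S by (rule domain_S)
  interpret M: primeideal M R by (rule M_primeideal)
  show ?thesis
  proof (rule S.TA_ideal_between_maximal_square[OF M_maximalideal])
    show "ideal (PIdl\<^bsub>S\<^esub> x) S" using S.cgenideal_ideal x_in_M M_subset_C by auto
    show "PIdl\<^bsub>S\<^esub> x \<subseteq> M"
      using C_subset unfolding cgenideal_S unfolding cgenideal_def by blast
    fix a b assume ab: "a \<in> M" "b \<in> M"
    then obtain r where "r \<in> carrier R" "b = r \<otimes> x" unfolding cgenideal_def by blast
    moreover have "a \<in> carrier R" using ab M.Icarr by blast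
    ultimately have "a \<otimes> b = (a \<otimes> r) \<otimes> x" "a \<otimes> r \<in> C"
      using x_closed M.I_r_closed[OF ab(1)] M_subset_C by (auto simp: m_assoc)
    then show "a \<otimes>\<^bsub>S\<^esub> b \<in> PIdl\<^bsub>S\<^esub> x" unfolding cgenideal_S by auto
  qed
qed

section \<open>Ideals of \<open>S\<close> compared with the ideals they generate in
  \<open>R\<close>\<close>

text \<open>Although \<open>I\<close> is closed only under multiplication by \<open>C\<close>, the
  element \<open>x r\<close> is in \<open>C\<close> for every \<open>r\<close> in \<open>R\<close>,
  so \<open>x\<close> carries all \<open>R\<close>-multiples of elements of \<open>I\<close> back
  into \<open>I\<close>.\<close>

lemma x_mult_genideal:
  assumes "ideal I S" "h \<in> Idl I"
  shows "x \<otimes> h \<in> I"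
proof -
  interpret S: domain S by (rule domain_S)
  interpret I: ideal I S by fact
  \<comment> \<open>Quantifying over \<open>r\<close> makes \<open>?T\<close> closed under
    multiplication by \<open>R\<close>, so it is an ideal of \<open>R\<close> containing
    \<open>I\<close>; the case \<open>r = 1\<close> gives the claim.\<close>
  let ?T = "{h \<in> carrier R. \<forall>r \<in> carrier R. x \<otimes> (h \<otimes> r) \<in> I}"
  have IC: "I \<subseteq> C" using I.a_subset by simp
  have "ideal ?T R"
  proof (rule idealI[OF ring_axioms])
    show "subgroup ?T (add_monoid R)"
    proof (rule add.subgroupI)
      show "?T \<noteq> {}"
        using I.zero_closed x_closed by (auto intro!: exI[of _ \<zero>])
    next
      fix a assume a: "a \<in> ?T"
      have "x \<otimes> (\<ominus> a \<otimes> r) = x \<otimes> (a \<otimes> \<ominus> r)" if "r \<in> carrier R" for r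
        using a that x_closed by (simp add: l_minus r_minus)
      then show "\<ominus> a \<in> ?T" using a by auto
    next
      fix a b assume "a \<in> ?T" "b \<in> ?T"
      then show "a \<oplus> b \<in> ?T"
        using x_closed I.a_closed by (auto simp: l_distr r_distr)
    qed auto
  next
    fix a y assume a: "a \<in> ?T" and y: "y \<in> carrier R"
    have "x \<otimes> (a \<otimes> y \<otimes> r) = x \<otimes> (a \<otimes> (y \<otimes> r))" if "r \<in> carrier R" for r
      using a y that by (simp add: m_assoc)
    then show "a \<otimes> y \<in> ?T" using a y by auto
    then show "y \<otimes> a \<in> ?T" using a y by (simp add: m_comm)
  qed
  moreover have "I \<subseteq> ?T"
  proof
    fix i assume i: "i \<in> I"
    have "x \<otimes> (i \<otimes> r) \<in> I" if r: "r \<in> carrier R" for r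
    proof -
      have "x \<otimes> (i \<otimes> r) = i \<otimes> (x \<otimes> r)"
        using i IC C_carrier r x_closed by (metis m_lcomm subsetD)
      then show ?thesis using I.I_r_closed[of i "x \<otimes> r"] i x_mult_C[OF r] by simp
    qed
    then show "i \<in> ?T" using i IC C_carrier by blast
  qed
  ultimately have "Idl I \<subseteq> ?T" by (rule genideal_minimal)
  then have "h \<in> carrier R" "x \<otimes> (h \<otimes> \<one>) \<in> I" using assms(2) by auto
  then show ?thesis by simp
qed

text \<open>A unit of \<open>R\<close> moves \<open>p\<close> into \<open>C\<close> without changing
  the prime ideal it generates in \<open>R\<close>. Then \<open>C_cancel\<close> puts the cofactors
  of elements of \<open>I\<close> into \<open>C\<close>.\<close>

lemma ideal_S_subset_prime:
  assumes I: "ideal I S" "I \<subseteq> PIdl p" and p: "p \<in> carrier R" "ring_irreducible p" "p \<notin> M"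
  shows "\<exists>g \<in> C - {\<zero>}. g \<notin> Units R \<and> TA_ideal (PIdl\<^bsub>S\<^esub> g) S \<and> I \<subseteq> PIdl\<^bsub>S\<^esub> g"
proof -
  interpret S: domain S by (rule domain_S)
  interpret I: ideal I S by fact
  interpret M: primeideal M R by (rule M_primeideal)
  obtain u where u: "u \<in> Units R" "u \<otimes> p \<in> C" using unit_multiple_C p by blast
  define g where "g = u \<otimes> p"
  have g: "g \<in> C" "g \<in> carrier R" using u C_carrier by (auto simp: g_def)
  have "g \<sim> p"
    by (rule associatedI2'[OF _ u(1) p(1)]) (use u p in \<open>simp_all add: g_def m_comm Units_closed\<close>)
  then have eq: "PIdl g = PIdl p"
    using associated_iff_same_ideal[OF g(2) p(1)] by simp
  have "g \<notin> M"
  proof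
    assume "g \<in> M"
    then have "inv u \<otimes> g \<in> M" using M.I_l_closed u by simp
    moreover have "inv u \<otimes> g = p" using u p by (simp add: g_def Units_closed flip: m_assoc)
    ultimately show False using p by simp
  qed
  have "primeideal (PIdl p) R"
    using p primeness_condition[OF p(1)] primeideal_iff_prime[of p]
    by (auto simp: ring_prime_def)
  then have prime: "primeideal (PIdl g) R" unfolding eq .
  have "g \<notin> Units R"
    using prime ideal_eq_carrier_iff[OF g(2)] primeideal.I_notcarr by metis
  moreover have "TA_ideal (PIdl\<^bsub>S\<^esub> g) S"
    using S.primeideal_imp_TA_ideal primeideal_cgenideal_S[OF g(1) \<open>g \<notin> M\<close> prime] by blast
  moreover have "g \<noteq> \<zero>" using \<open>g \<notin> M\<close> by auto
  moreover have "I \<subseteq> PIdl\<^bsub>S\<^esub> g"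
  proof
    fix i assume "i \<in> I"
    moreover from this obtain r where "r \<in> carrier R" "i = r \<otimes> g"
      using I(2) unfolding eq[symmetric] unfolding cgenideal_def by blast
    ultimately show "i \<in> PIdl\<^bsub>S\<^esub> g"
      using C_cancel[OF g(1) \<open>g \<notin> M\<close>] I.a_subset unfolding cgenideal_S by fastforce
  qed
  ultimately show ?thesis using g by blast
qed

text \<open>This is the dichotomy behind the induction: either \<open>I\<close> is already a factor,
  or a principal 2-absorbing ideal containing \<open>I\<close> can be split off. The nonzero
  \<open>a\<close> keeps the generator \<open>f\<close> of \<open>Idl I\<close> nonzero, so that
  irreducible divisors are available.\<close>

lemma TA_ideal_or_subset_cgenideal:
  assumes I: "ideal I S" "I \<noteq> C" and a: "a \<in> I" "a \<noteq> \<zero>"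
  shows "TA_ideal I S \<or>
    (\<exists>g \<in> C - {\<zero>}. g \<notin> Units R \<and> TA_ideal (PIdl\<^bsub>S\<^esub> g) S \<and> I \<subseteq> PIdl\<^bsub>S\<^esub> g)"
proof (cases "\<exists>p \<in> carrier R. ring_irreducible p \<and> p \<notin> M \<and> I \<subseteq> PIdl p")
  case True
  then show ?thesis using ideal_S_subset_prime I(1) by blast
next
  case False
  interpret S: domain S by (rule domain_S)
  interpret I: ideal I S by fact
  interpret M: primeideal M R by (rule M_primeideal)
  interpret MS: maximalideal M S by (rule M_maximalideal)
  have "I \<subseteq> C" using I.a_subset by simp
  then have IR: "I \<subseteq> carrier R" using C_subset by blast
  obtain f where f: "f \<in> carrier R" "Idl I = PIdl f"
    using exists_gen[OF genideal_ideal[OF IR]] by blast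
  have If: "I \<subseteq> PIdl f" using genideal_self[OF IR] f by simp
  have xf: "x \<otimes> h \<in> I" if "h \<in> PIdl f" for h
    using x_mult_genideal[OF I(1)] that f by blast
  obtain b where "b \<in> carrier R" "a = b \<otimes> f"
    using If a unfolding cgenideal_def by blast
  then have f0: "f \<noteq> \<zero>" using a by auto
  \<comment> \<open>In the remaining case every irreducible divisor of \<open>f\<close> lies in
    \<open>M\<close>.\<close>
  have irr_in_M: "p \<in> M" if "p \<in> carrier R" "ring_irreducible p" "p divides f" for p
  proof -
    have "PIdl f \<subseteq> PIdl p" using to_contain_is_to_divide[OF that(1) f(1)] that(3) by simp
    then have "I \<subseteq> PIdl p" using If by (rule order_trans[rotated])
    then show ?thesis using False that(1,2) by metis
  qed
  show ?thesis
  proof (cases "f \<in> Units R")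
    case True
    \<comment> \<open>Here \<open>f\<close> generates all of \<open>R\<close>, so \<open>xf\<close>
      says that every multiple of \<open>x\<close> is in \<open>I\<close>.\<close>
    then have "M \<subseteq> I"
      using xf ideal_eq_carrier_iff[OF f(1)] m_comm[OF _ x_closed]
      unfolding cgenideal_def[of R x] by auto
    then have "I = M"
      using MS.I_maximal[OF I(1)] I.a_subset I(2) by auto
    then show ?thesis
      using S.primeideal_imp_TA_ideal[OF S.maximalideal_prime[OF M_maximalideal]] by simp
  next
    case nonunit: False
    then obtain p where p: "p \<in> carrier R" "ring_irreducible p" "p divides f"
      using exists_irreducible_divisor[of f] f(1) f0 by blast
    then have "f \<in> M"
      using irr_in_M[OF p] M.I_r_closed unfolding factor_def by blast
    then obtain f' where f': "f' \<in> carrier R" "f = f' \<otimes> x" unfolding cgenideal_def by blast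
    show ?thesis
    proof (cases "f' \<in> Units R")
      case True
      then have "f \<sim> x"
        by (intro associatedI2'[OF _ True x_closed]) (use f' x_closed in \<open>simp add: m_comm\<close>)
      then have eq: "PIdl f = M" using associated_iff_same_ideal[OF f(1) x_closed] by simp
      have "TA_ideal I S"
      proof (rule S.TA_ideal_between_maximal_square[OF M_maximalideal I(1)])
        show "I \<subseteq> M" using If eq by simp
        fix a b assume "a \<in> M" "b \<in> M"
        then obtain r where r: "r \<in> carrier R" "a = r \<otimes> x" unfolding cgenideal_def by blast
        have "b \<in> carrier R" using \<open>b \<in> M\<close> M.Icarr by blast
        then have "a \<otimes> b = x \<otimes> (r \<otimes> b)" using r x_closed by (simp add: m_ac)
        moreover have "r \<otimes> b \<in> PIdl f" unfolding eq using r \<open>b \<in> M\<close> M.I_l_closed by simp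
        ultimately show "a \<otimes>\<^bsub>S\<^esub> b \<in> I" using xf by simp
      qed
      then show ?thesis ..
    next
      case False
      have "f' \<noteq> \<zero>" using f' f0 x_closed by auto
      then obtain q where q: "q \<in> carrier R" "ring_irreducible q" "q divides f'"
        using exists_irreducible_divisor[of f'] f'(1) False by blast
      \<comment> \<open>Through \<open>f\<close>, the divisor \<open>q\<close> of \<open>f'\<close>
        falls under \<open>irr_in_M\<close>. So \<open>f'\<close> is in \<open>M\<close> too, that
        is, the square of \<open>x\<close> divides \<open>f\<close>.\<close>
      then have "q divides f"
        using divides_trans[OF q(3) dividesI[OF x_closed f'(2)] q(1)] by simp
      then have "f' \<in> M"
        using irr_in_M[OF q(1,2)] q(3) M.I_r_closed unfolding factor_def by blast
      have "I \<subseteq> PIdl\<^bsub>S\<^esub> x"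
      proof
        fix i assume "i \<in> I"
        then obtain r where r: "r \<in> carrier R" "i = r \<otimes> f" using If unfolding cgenideal_def by blast
        then have "i = (r \<otimes> f') \<otimes> x" using f' x_closed by (simp add: m_assoc)
        moreover have "r \<otimes> f' \<in> C" using M.I_l_closed[OF \<open>f' \<in> M\<close> r(1)] M_subset_C by blast
        ultimately show "i \<in> PIdl\<^bsub>S\<^esub> x" unfolding cgenideal_S by blast
      qed
      moreover have "x \<in> C - {\<zero>}" using x_in_M M_subset_C x_prime by (auto simp: ring_prime_def)
      moreover have "x \<notin> Units R"
        using ideal_eq_carrier_iff[OF x_closed] M.I_notcarr by blast
      ultimately show ?thesis using TA_ideal_cgenideal_x by blast
    qed
  qed
qed

section \<open>Factorization by induction on proper divisors\<close>

lemma ideal_S_eq_TA_prod: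
  assumes "a \<in> carrier R" "a \<noteq> \<zero>" "a \<in> I" "ideal I S"
  shows "\<exists>Js. (\<forall>J \<in> set Js. TA_ideal J S \<and> J \<noteq> C) \<and> I = foldr (ideal_prod S) Js C"
proof -
  interpret S: domain S by (rule domain_S)
  have "a \<in> carrier (mult_of R)" using assms by simp
  with mult_of.division_wellfounded show ?thesis
    using assms(3,4)
  proof (induction a arbitrary: I rule: wf_induct_rule)
    case (less a)
    interpret I: ideal I S by (rule less.prems)
    show ?case
    proof (cases "I = C")
      case True
      then show ?thesis by (intro exI[of _ "[]"]) simp
    next
      case proper: False
      consider "TA_ideal I S"
        | g where "g \<in> C" "g \<noteq> \<zero>" "g \<notin> Units R" "TA_ideal (PIdl\<^bsub>S\<^esub> g) S" "I \<subseteq> PIdl\<^bsub>S\<^esub> g"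
        using TA_ideal_or_subset_cgenideal[of I a] less.prems proper by auto
      then show ?thesis
      proof cases
        case 1
        then show ?thesis
          using proper S.ideal_prod_one[OF less.prems(3)] by (intro exI[of _ "[I]"]) simp
      next
        case 2
        define I' where "I' = {h \<in> carrier S. g \<otimes>\<^bsub>S\<^esub> h \<in> I}"
        have I': "ideal I' S"
          unfolding I'_def using S.ideal_colon_element[OF less.prems(3)] 2 by simp
        have prod: "I = (PIdl\<^bsub>S\<^esub> g) \<cdot>\<^bsub>S\<^esub> I'"
          unfolding I'_def using S.ideal_prod_cgenideal_colon[OF less.prems(3)] 2 by simp
        have g: "g \<in> carrier R" using 2 C_carrier by blast
        obtain h where h: "h \<in> C" "a = h \<otimes> g"
          using 2 less.prems unfolding cgenideal_S by blast
        have hR: "h \<in> carrier R" using h C_carrier by blast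
        have "h \<noteq> \<zero>" using h g less.prems by auto
        \<comment> \<open>The cofactor \<open>g\<close> is not a unit of \<open>R\<close>, so the
          divisor \<open>h\<close> of \<open>a\<close> is proper.\<close>
        moreover have "properfactor (mult_of R) h a"
          by (rule mult_of.properfactorI3[of _ _ g])
             (use h hR g 2 \<open>h \<noteq> \<zero>\<close> in auto)
        moreover have "h \<in> I'" using h hR g less.prems by (simp add: I'_def m_comm)
        ultimately obtain Js where
          "\<forall>J \<in> set Js. TA_ideal J S \<and> J \<noteq> C" "I' = foldr (ideal_prod S) Js C"
          using less.IH[of h I'] less.prems hR I' by auto
        moreover have "PIdl\<^bsub>S\<^esub> g \<noteq> C"
        proof
          assume "PIdl\<^bsub>S\<^esub> g = C"
          then obtain s where s: "s \<in> C" "\<one> = s \<otimes> g"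
            using subringE(3)[OF subring_C] unfolding cgenideal_S by blast
          then have "g divides \<one>"
            using dividesI[OF C_carrier[OF s(1)], of \<one> g] g C_carrier[OF s(1)] by (simp add: m_comm)
          then have "g \<in> Units R" using divides_one[OF g] by simp
          with 2 show False by simp
        qed
        ultimately show ?thesis
          using prod 2 by (intro exI[of _ "(PIdl\<^bsub>S\<^esub> g) # Js"]) simp
      qed
    qed
  qed
qed

theorem TAF_domain_pullback: "TAF_domain S"
proof -
  interpret S: domain S by (rule domain_S)
  have "\<exists>Js. TA_factorization Js I S" if I: "ideal I S" "I \<noteq> C" for I
  proof (cases "I = {\<zero>}")
    case True
    \<comment> \<open>The zero ideal offers no nonzero element for the induction, but it is prime
      because \<open>S\<close> is a domain.\<close>
    have "TA_ideal I S"
      using S.primeideal_imp_TA_ideal[OF S.zeroprimeideal] True by simp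
    then show ?thesis
      unfolding TA_factorization_def
      using I S.ideal_prod_one[OF I(1)] by (intro exI[of _ "[I]"]) simp
  next
    case False
    interpret I: ideal I S by (rule I)
    obtain a where "a \<in> I" "a \<noteq> \<zero>" using False I.zero_closed by auto
    moreover have "a \<in> carrier R" using \<open>a \<in> I\<close> I.a_subset C_carrier by auto
    ultimately obtain Js where
      Js: "\<forall>J \<in> set Js. TA_ideal J S \<and> J \<noteq> C" "I = foldr (ideal_prod S) Js C"
      using ideal_S_eq_TA_prod I by blast
    moreover have "Js \<noteq> []" using Js I by auto
    ultimately show ?thesis unfolding TA_factorization_def by auto
  qed
  then show ?thesis unfolding TAF_domain_def using domain_S by simp
qed

end

section \<open>The instance \<open>K + X L[X]\<close>\<close>

text \<open>The constant term is the value at zero, so it is multiplicative and vanishes on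
  \<open>X\<close>. Conversely, coefficient lists end with the constant term, and dropping a final
  zero divides by \<open>X\<close>.\<close>

lemma (in domain) cgenideal_var_iff_const_term:
  assumes "subring F R" "p \<in> carrier (F[X])"
  shows "p \<in> PIdl\<^bsub>F[X]\<^esub> X \<longleftrightarrow> const_term p = \<zero>"
proof
  interpret UP: domain "F[X]" by (rule univ_poly_is_domain[OF assms(1)])
  note X = var_closed(1)[OF assms(1)]
  assume "p \<in> PIdl\<^bsub>F[X]\<^esub> X"
  then obtain q where q: "q \<in> carrier (F[X])" "p = q \<otimes>\<^bsub>F[X]\<^esub> X"
    unfolding cgenideal_def by blast
  have "const_term q \<in> carrier R"
    using const_term_simprules_shell(1)[OF assms(1) q(1)] subringE(1)[OF assms(1)] by blast
  then show "const_term p = \<zero>"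
    using const_term_simprules_shell(2)[OF assms(1) q(1) X] q(2) eval_var[OF zero_closed]
    by (simp add: const_term_def)
next
  interpret UP: domain "F[X]" by (rule univ_poly_is_domain[OF assms(1)])
  note X = var_closed(1)[OF assms(1)]
  assume *: "const_term p = \<zero>"
  show "p \<in> PIdl\<^bsub>F[X]\<^esub> X"
  proof (cases "p = []")
    case True
    then show ?thesis
      using additive_subgroup.zero_closed[OF ideal.axioms(1)[OF UP.cgenideal_ideal[OF X]]]
      by (simp add: univ_poly_zero)
  next
    case False
    then obtain q where q: "polynomial F q" "q \<noteq> []" "p = q @ [\<zero>]"
      using const_term_zero[OF assms(1)] assms(2) * univ_poly_carrier by metis
    then have "q \<in> carrier (F[X])" by (simp add: univ_poly_carrier)
    moreover from this have "p = q \<otimes>\<^bsub>F[X]\<^esub> X"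
      using poly_mult_var[OF assms(1)] q by simp
    ultimately show ?thesis unfolding cgenideal_def by blast
  qed
qed

theorem corollary4p8:
  fixes L :: "('a, 'b) ring_scheme" and K :: "'a set"
  assumes "field L" and "subfield K L"
  shows "TAF_domain (const_term_subring K L)"
proof -
  interpret L: field L by fact
  define P where "P = univ_poly L (carrier L)"
  define x where "x = [\<one>\<^bsub>L\<^esub>, \<zero>\<^bsub>L\<^esub>]"
  define C where "C = {p \<in> carrier P. L.const_term p \<in> K}"
  note cs = L.carrier_is_subring
  interpret P: principal_domain P
    unfolding P_def by (rule L.univ_poly_is_principal[OF L.carrier_is_subfield])
  have x: "x \<in> carrier P"
    using L.var_closed(1)[OF cs] by (simp add: var_def x_def P_def)
  have in_M: "p \<in> PIdl\<^bsub>P\<^esub> x \<longleftrightarrow> L.const_term p = \<zero>\<^bsub>L\<^esub>" if "p \<in> carrier P" for p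
    using L.cgenideal_var_iff_const_term[OF cs] that by (simp add: P_def x_def var_def)
  note [simp] = L.const_term_simprules_shell[OF cs, folded P_def]
  have const [simp]: "L.const_term [k] = k" if "k \<in> carrier L" for k
    using that by (simp add: L.const_term_def)
  have one [simp]: "L.const_term \<one>\<^bsub>P\<^esub> = \<one>\<^bsub>L\<^esub>"
    by (simp add: P_def univ_poly_one)
  note KE = subringE[OF subfieldE(1)[OF assms(2)]]
  have inv_closed: "inv\<^bsub>L\<^esub> k \<in> carrier L" "inv\<^bsub>L\<^esub> k \<noteq> \<zero>\<^bsub>L\<^esub>" "inv\<^bsub>L\<^esub> k \<otimes>\<^bsub>L\<^esub> k = \<one>\<^bsub>L\<^esub>"
      "k \<otimes>\<^bsub>L\<^esub> inv\<^bsub>L\<^esub> k = \<one>\<^bsub>L\<^esub>"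
    if "k \<in> carrier L" "k \<noteq> \<zero>\<^bsub>L\<^esub>" for k
    using that L.field_Units by (auto dest: L.Units_inv_Units)
  have const_Units: "[k] \<in> Units P" if "k \<in> carrier L" "k \<noteq> \<zero>\<^bsub>L\<^esub>" for k
    unfolding P_def L.univ_poly_units[OF L.carrier_is_subfield] using that by blast
  interpret principal_domain_pullback P C x
  proof (intro principal_domain_pullback.intro principal_domain_pullback_axioms.intro
      P.principal_domain_axioms)
    show "subring C P"
    proof (rule P.subringI)
      show "C \<subseteq> carrier P" by (auto simp: C_def)
      show "\<one>\<^bsub>P\<^esub> \<in> C" using KE(3) by (simp add: C_def)
      fix p assume p: "p \<in> C"
      then show "\<ominus>\<^bsub>P\<^esub> p \<in> C" using KE(5) by (simp add: C_def)
      fix q assume "q \<in> C"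
      then show "p \<otimes>\<^bsub>P\<^esub> q \<in> C" "p \<oplus>\<^bsub>P\<^esub> q \<in> C" using p KE(6,7) by (simp_all add: C_def)
    qed
    show "x \<in> carrier P" by (rule x)
    have "ring_irreducible\<^bsub>P\<^esub> x"
      using L.degree_one_imp_pirreducible[OF L.carrier_is_subfield, of x] x
      by (simp add: x_def P_def)
    then show "ring_prime\<^bsub>P\<^esub> x" using P.primeness_condition[OF x] by simp
    fix p assume p: "p \<in> carrier P"
    have "x \<otimes>\<^bsub>P\<^esub> p \<in> PIdl\<^bsub>P\<^esub> x"
      using p x P.m_comm unfolding cgenideal_def by blast
    then show "x \<otimes>\<^bsub>P\<^esub> p \<in> C" using in_M[of "x \<otimes>\<^bsub>P\<^esub> p"] p x KE(2) by (simp add: C_def)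
  next
    fix a assume a: "a \<in> C" "a \<notin> PIdl\<^bsub>P\<^esub> x"
    define c where "c = L.const_term a"
    have c: "c \<in> K" "c \<noteq> \<zero>\<^bsub>L\<^esub>" "c \<in> carrier L" "a \<in> carrier P"
      using a in_M KE(1) by (auto simp: C_def c_def)
    \<comment> \<open>The constant \<open>c\<close> lies in the subfield \<open>K\<close>, hence so
      does its inverse, and the constant polynomial \<open>s\<close> is in \<open>C\<close>.\<close>
    define s where "s = [inv\<^bsub>L\<^esub> c]"
    have s: "s \<in> carrier P" "s \<in> C"
      using const_Units[of "inv\<^bsub>L\<^esub> c"] inv_closed[of c] c L.subfield_m_inv(1)[OF assms(2)]
      by (auto simp: s_def C_def)
    define m where "m = a \<otimes>\<^bsub>P\<^esub> s \<ominus>\<^bsub>P\<^esub> \<one>\<^bsub>P\<^esub>"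
    have "L.const_term m = \<zero>\<^bsub>L\<^esub>"
      using c s inv_closed[of c]
      by (simp add: m_def a_minus_def L.r_neg s_def flip: c_def)
    moreover have "m \<in> carrier P" using c s by (simp add: m_def)
    ultimately have "m \<in> PIdl\<^bsub>P\<^esub> x" using in_M by simp
    moreover have "a \<otimes>\<^bsub>P\<^esub> s = \<one>\<^bsub>P\<^esub> \<oplus>\<^bsub>P\<^esub> m"
      using c s P.a_comm[of "a \<otimes>\<^bsub>P\<^esub> s" "\<ominus>\<^bsub>P\<^esub> \<one>\<^bsub>P\<^esub>"]
      by (simp add: m_def a_minus_def P.r_neg2)
    ultimately show "\<exists>s\<in>C. \<exists>m\<in>PIdl\<^bsub>P\<^esub> x. a \<otimes>\<^bsub>P\<^esub> s = \<one>\<^bsub>P\<^esub> \<oplus>\<^bsub>P\<^esub> m"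
      using s by blast
  next
    fix a assume a: "a \<in> carrier P" "a \<notin> PIdl\<^bsub>P\<^esub> x"
    define c where "c = L.const_term a"
    have c: "c \<in> carrier L" "c \<noteq> \<zero>\<^bsub>L\<^esub>" using a in_M by (auto simp: c_def)
    \<comment> \<open>Now \<open>c\<close> is only known to lie in \<open>L\<close>. Its inverse
      need not be in \<open>K\<close>, but as a constant it is a unit of \<open>L[X]\<close>, and it
      scales the constant term of \<open>a\<close> to 1.\<close>
    have u: "[inv\<^bsub>L\<^esub> c] \<in> Units P" "[inv\<^bsub>L\<^esub> c] \<in> carrier P"
      using const_Units[of "inv\<^bsub>L\<^esub> c"] inv_closed[of c] c by auto
    moreover have "[inv\<^bsub>L\<^esub> c] \<otimes>\<^bsub>P\<^esub> a \<in> C"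
      using u a c inv_closed[of c] KE(3)
      by (simp add: C_def flip: c_def)
    ultimately show "\<exists>u\<in>Units P. u \<otimes>\<^bsub>P\<^esub> a \<in> C" by blast
  qed
  have "const_term_subring K L = P\<lparr>carrier := C\<rparr>"
    by (simp add: const_term_subring_def C_def P_def)
  then show ?thesis using TAF_domain_pullback by simp
qed

end
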